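(* Let $K$ be a field, let $n, t \ge 1$, and let $A \in K^{nt \times nt}$. The following statements are equivalent. (i) $A = F_P$ for some $P \in K^{nt \times t}$. (ii) $R(A, E_0) = I_{nt}$. (iii) $R(A, G) = G(A)$ for all $G \in K^{nt \times m}$ and all positive integers $m$. (iv) The identity $$[B, AB, \dots, A^{n-1} B]\, G = [G, AG, \dots, A^{n-1} G]\, B$$ holds for all blockwise commuting matrices $B, G \in K^{nt \times t}$.
   Context: For $P = \begin{bmatrix} P_0 \\ \vdots \\ P_{n-1} \end{bmatrix} \in K^{nt \times t}$ with blocks $P_i \in K^{t \times t}$, the block companion matrix of the second type is $$F_P = \begin{bmatrix} 0 & 0 & \cdots & 0 & P_0 \\ I_t & 0 & \cdots & 0 & P_1 \\ 0 & I_t & \ddots & \vdots & \vdots \\ \vdots & & \ddots & 0 & P_{n-2} \\ 0 & 0 & \cdots & I_t & P_{n-1} \end{bmatrix} \in K^{nt \times nt}.$$ With $e_0, \dots, e_{n-1}$ the standard unit vectors of $K^n$ and $\otimes$ the Kronecker product ($S \otimes T = (s_{ij} T)$), put $E_i = e_i \otimes I_t \in K^{nt \times t}$; in particular $E_0 = [I_t, 0, \dots, 0]^T$. For $B \in K^{nt \times m}$, the $n$-step reachability matrix of $(A, B)$ is $R(A, B) = [B, AB, \dots, A^{n-1} B] \in K^{nt \times nm}$. For $B = \begin{bmatrix} B_0 \\ \vdots \\ B_{n-1} \end{bmatrix} \in K^{nt \times m}$ with blocks $B_j \in K^{t \times m}$, define $$B(A) = (I_n \otimes B_0) + A (I_n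 \otimes B_1) + \cdots + A^{n-1} (I_n \otimes B_{n-1}) \in K^{nt \times nm}.$$ Two matrices $B, G \in K^{nt \times t}$ with $t \times t$ blocks $B_0, \dots, B_{n-1}$ and $G_0, \dots, G_{n-1}$ are called blockwise commuting if $B_i G_j = G_j B_i$ for all $i, j = 0, \dots, n-1$. *)

theory Defs
  imports "Jordan_Normal_Form.Matrix"
begin

text \<open>All indices, of entries and of blocks, are 0-based.\<close>

definition mat_of_blocks :: "nat \<Rightarrow> nat \<Rightarrow> nat \<Rightarrow> nat \<Rightarrow> (nat \<Rightarrow> nat \<Rightarrow> 'a mat) \<Rightarrow> 'a mat" where
  \<comment> \<open>\<open>p\<close> block rows and \<open>q\<close> block columns; every block \<open>f i j\<close> is expected to be \<open>r \<times> c\<close>\<close>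
  "mat_of_blocks p q r c f =
     mat (p * r) (q * c) (\<lambda>(i, j). f (i div r) (j div c) $$ (i mod r, j mod c))"

definition row_block :: "nat \<Rightarrow> 'a mat \<Rightarrow> nat \<Rightarrow> 'a mat" where
  \<comment> \<open>the block \<open>B\<^sub>i\<close> of a matrix \<open>B\<close> partitioned into blocks of \<open>t\<close> consecutive rows\<close>
  "row_block t B i = mat t (dim_col B) (\<lambda>(r, c). B $$ (i * t + r, c))"

definition kronecker_product :: "'a :: times mat \<Rightarrow> 'a mat \<Rightarrow> 'a mat" (infixl "\<otimes>\<^sub>K" 72) where
  "S \<otimes>\<^sub>K T = mat_of_blocks (dim_row S) (dim_col S) (dim_row T) (dim_col T)
     (\<lambda>i j. S $$ (i, j) \<cdot>\<^sub>m T)"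

definition block_companion :: "nat \<Rightarrow> nat \<Rightarrow> 'a :: {zero, one} mat \<Rightarrow> 'a mat" where
  \<comment> \<open>For \<open>n = 1\<close> the only block column is the last one, so the matrix is \<open>P\<^sub>0\<close>.\<close>
  "block_companion n t P = mat_of_blocks n n t t
     (\<lambda>i j. if j = n - 1 then row_block t P i
            else if i = j + 1 then 1\<^sub>m t
            else 0\<^sub>m t t)"

definition unit_block :: "nat \<Rightarrow> nat \<Rightarrow> nat \<Rightarrow> 'a :: semiring_1 mat" where
  "unit_block n t i = mat_of_cols n [unit_vec n i] \<otimes>\<^sub>K 1\<^sub>m t"

definition reachability_mat :: "nat \<Rightarrow> 'a :: semiring_1 mat \<Rightarrow> 'a mat \<Rightarrow> 'a mat" where
  "reachability_mat n A B =
     mat_of_blocks 1 n (dim_row B) (dim_col B) (\<lambda>_ k. A ^\<^sub>m k * B)"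

definition block_eval :: "nat \<Rightarrow> nat \<Rightarrow> 'a :: semiring_1 mat \<Rightarrow> 'a mat \<Rightarrow> 'a mat" where
  \<comment> \<open>\<open>B(A)\<close>; the sum of matrices is written entrywise because the type of matrices, having
     no zero common to all dimensions, is not an instance of the class that \<open>\<Sum>\<close> requires\<close>
  "block_eval n t A B = mat (n * t) (n * dim_col B)
     (\<lambda>(r, c). \<Sum>i<n. (A ^\<^sub>m i * (1\<^sub>m n \<otimes>\<^sub>K row_block t B i)) $$ (r, c))"

definition blockwise_commuting :: "nat \<Rightarrow> nat \<Rightarrow> 'a :: semiring_0 mat \<Rightarrow> 'a mat \<Rightarrow> bool" where
  "blockwise_commuting n t B G \<longleftrightarrow>
     (\<forall>i<n. \<forall>j<n. row_block t B i * row_block t G j = row_block t G j * row_block t B i)"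

end

theory Submission
  imports Defs
begin

text \<open>The pivot is (ii), which says that \<open>A\<close> shifts the block unit vectors: \<open>A\<^sup>k E\<^sub>0 = E\<^sub>k\<close> for
  \<open>k < n\<close>. It holds exactly when the first \<open>n - 1\<close> block columns of \<open>A\<close> are those of a companion
  matrix. Under (ii), \<open>G = \<Sum>\<^sub>i A\<^sup>i E\<^sub>0 G\<^sub>i\<close>; multiplying by \<open>A\<^sup>k\<close> and commuting powers of \<open>A\<close> gives
  the \<open>k\<close>-th block column \<open>\<Sum>\<^sub>i A\<^sup>i E\<^sub>k G\<^sub>i\<close> of \<open>G(A)\<close>, hence (iii), and turns \<open>R(A, B) G\<close> into
  \<open>\<Sum>\<^sub>k \<Sum>\<^sub>i A\<^sup>k\<^sup>+\<^sup>i E\<^sub>0 B\<^sub>i G\<^sub>k\<close>, which is symmetric for blockwise commuting \<open>B\<close>, \<open>G\<close>, hence (iv).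
  Conversely, (iii) at \<open>G = E\<^sub>0\<close> is (ii), because \<open>E\<^sub>0(A) = I\<close>; and (iv) at \<open>B = E\<^sub>0\<close>, \<open>G = E\<^sub>k\<close> reads
  \<open>R(A, E\<^sub>0) E\<^sub>k = R(A, E\<^sub>k) E\<^sub>0 = E\<^sub>k\<close>.\<close>

section \<open>Matrix products and finite sums of matrices\<close>

lemma index_mult_mat_sum:
  assumes "A \<in> carrier_mat p q" and "B \<in> carrier_mat q s" and "r < p" and "c < s"
  shows "(A * B) $$ (r, c) = (\<Sum>j<q. A $$ (r, j) * B $$ (j, c))"
  using assms by (auto simp: scalar_prod_def lessThan_atLeast0 intro!: sum.cong)

text \<open>The dimensions are parameters so that the empty sum is still a zero matrix of a definite
  size.\<close>

definition mat_sum :: "nat \<Rightarrow> nat \<Rightarrow> ('i \<Rightarrow> 'a :: comm_monoid_add mat) \<Rightarrow> 'i set \<Rightarrow> 'a mat" where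
  "mat_sum nr nc f I = mat nr nc (\<lambda>(r, c). \<Sum>i\<in>I. f i $$ (r, c))"

lemma mat_sum_carrier [simp, intro]: "mat_sum nr nc f I \<in> carrier_mat nr nc"
  and dim_mat_sum [simp]: "dim_row (mat_sum nr nc f I) = nr" "dim_col (mat_sum nr nc f I) = nc"
  and index_mat_sum [simp]:
    "r < nr \<Longrightarrow> c < nc \<Longrightarrow> mat_sum nr nc f I $$ (r, c) = (\<Sum>i\<in>I. f i $$ (r, c))"
  by (simp_all add: mat_sum_def)

lemma mat_sum_cong: "(\<And>i. i \<in> I \<Longrightarrow> f i = g i) \<Longrightarrow> mat_sum nr nc f I = mat_sum nr nc g I"
  by (auto simp: mat_sum_def intro!: sum.cong)

lemma mat_sum_swap:
  "mat_sum nr nc (\<lambda>i. mat_sum nr nc (f i) J) I = mat_sum nr nc (\<lambda>j. mat_sum nr nc (\<lambda>i. f i j) I) J"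
  by (rule eq_matI) (auto intro: sum.swap)

lemma mult_mat_sum:
  fixes A :: "'a :: semiring_0 mat"
  assumes A: "A \<in> carrier_mat nr p" and f: "\<And>i. i \<in> I \<Longrightarrow> f i \<in> carrier_mat p nc"
  shows "A * mat_sum p nc f I = mat_sum nr nc (\<lambda>i. A * f i) I"
proof (rule eq_matI)
  fix r c assume "r < dim_row (mat_sum nr nc (\<lambda>i. A * f i) I)"
    and "c < dim_col (mat_sum nr nc (\<lambda>i. A * f i) I)"
  then have rc: "r < nr" "c < nc" by auto
  have "(A * mat_sum p nc f I) $$ (r, c) = (\<Sum>k<p. \<Sum>i\<in>I. A $$ (r, k) * f i $$ (k, c))"
    using A rc by (subst index_mult_mat_sum[of _ nr p _ nc]) (auto simp: sum_distrib_left)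
  also have "\<dots> = (\<Sum>i\<in>I. \<Sum>k<p. A $$ (r, k) * f i $$ (k, c))"
    by (rule sum.swap)
  also have "\<dots> = (\<Sum>i\<in>I. (A * f i) $$ (r, c))"
    using index_mult_mat_sum[OF A f rc] by simp
  finally show "(A * mat_sum p nc f I) $$ (r, c) = mat_sum nr nc (\<lambda>i. A * f i) I $$ (r, c)"
    using rc by simp
qed (use A in auto)

lemma mat_sum_mult:
  fixes A :: "'a :: semiring_0 mat"
  assumes A: "A \<in> carrier_mat p nc" and f: "\<And>i. i \<in> I \<Longrightarrow> f i \<in> carrier_mat nr p"
  shows "mat_sum nr p f I * A = mat_sum nr nc (\<lambda>i. f i * A) I"
proof (rule eq_matI)
  fix r c assume "r < dim_row (mat_sum nr nc (\<lambda>i. f i * A) I)"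
    and "c < dim_col (mat_sum nr nc (\<lambda>i. f i * A) I)"
  then have rc: "r < nr" "c < nc" by auto
  have "(mat_sum nr p f I * A) $$ (r, c) = (\<Sum>k<p. \<Sum>i\<in>I. f i $$ (r, k) * A $$ (k, c))"
    using A rc by (subst index_mult_mat_sum[of _ nr p _ nc]) (auto simp: sum_distrib_right)
  also have "\<dots> = (\<Sum>i\<in>I. \<Sum>k<p. f i $$ (r, k) * A $$ (k, c))"
    by (rule sum.swap)
  also have "\<dots> = (\<Sum>i\<in>I. (f i * A) $$ (r, c))"
    using index_mult_mat_sum[OF f A rc] by simp
  finally show "(mat_sum nr p f I * A) $$ (r, c) = mat_sum nr nc (\<lambda>i. f i * A) I $$ (r, c)"
    using rc by simp
qed (use A in auto)

section \<open>Block indices as division with remainder by the block size\<close>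

lemma block_index_less:
  fixes k c n t :: nat
  assumes "k < n" and "c < t"
  shows "k * t + c < n * t"
proof -
  have "k * t + c < Suc k * t" using assms by simp
  also have "\<dots> \<le> n * t" using assms by (intro mult_le_mono1) simp
  finally show ?thesis .
qed

lemma eq_block_index_iff:
  fixes r i c t :: nat
  assumes "c < t"
  shows "r = i * t + c \<longleftrightarrow> r div t = i \<and> r mod t = c"
  using assms div_mult_mod_eq[of r t] by auto

lemma block_indices_less:
  fixes j n t :: nat
  assumes "j < n * t"
  shows "j div t < n" and "j mod t < t"
  using assms by (cases "t = 0"; simp add: less_mult_imp_div_less)+

lemma sum_blocks:
  fixes f :: "nat \<Rightarrow> 'a :: comm_monoid_add"
  shows "sum f {..<n * t} = (\<Sum>k<n. \<Sum>c<t. f (k * t + c))"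
proof -
  have "sum f {k * t..<k * t + t} = (\<Sum>c<t. f (k * t + c))" for k
    using sum.shift_bounds_nat_ivl[of f 0 "k * t" t]
    by (simp add: lessThan_atLeast0 add.commute)
  then show ?thesis by (simp flip: sum.nat_group)
qed

section \<open>Block unit vectors and block columns\<close>

lemma unit_block_carrier [simp, intro]: "unit_block n t i \<in> carrier_mat (n * t) t"
  and dim_unit_block [simp]: "dim_row (unit_block n t i) = n * t" "dim_col (unit_block n t i) = t"
  by (simp_all add: unit_block_def kronecker_product_def mat_of_blocks_def)

lemma index_unit_block:
  assumes "r < n * t" and "c < t" and "i < n"
  shows "unit_block n t i $$ (r, c) = (if r = i * t + c then 1 else 0)"
proof -
  note block_indices_less[OF assms(1)]
  then show ?thesis using assms
    by (auto simp: eq_block_index_iff unit_block_def kronecker_product_def mat_of_blocks_def mat_of_cols_def)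
qed

lemma row_block_carrier [simp, intro]: "B \<in> carrier_mat p m \<Longrightarrow> row_block t B i \<in> carrier_mat t m"
  by (auto simp: row_block_def)

lemma row_block_unit_block:
  assumes "i < n" and "k < n"
  shows "row_block t (unit_block n t k) i = (if i = k then 1\<^sub>m t else 0\<^sub>m t t)"
proof (rule eq_matI)
  fix r c assume "r < dim_row (if i = k then 1\<^sub>m t else 0\<^sub>m t t :: 'a mat)"
    "c < dim_col (if i = k then 1\<^sub>m t else 0\<^sub>m t t :: 'a mat)"
  then have rc: "r < t" "c < t" by (auto split: if_splits)
  have "i * t + r = k * t + c \<longleftrightarrow> i = k \<and> r = c"
    unfolding eq_block_index_iff[OF rc(2)] using rc by simp
  then show "row_block t (unit_block n t k) i $$ (r, c) = (if i = k then 1\<^sub>m t else 0\<^sub>m t t) $$ (r, c)"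
    using rc assms block_index_less[of i n r t] by (auto simp: row_block_def index_unit_block)
qed (auto simp: row_block_def)

text \<open>Column \<open>c\<close> of \<open>unit_block n t k\<close> has its single nonzero entry
  in row \<open>k * t + c\<close>, so multiplying by it from the right extracts block column
  \<open>k\<close>.\<close>

lemma index_mult_unit_block:
  fixes M :: "'a :: semiring_1 mat"
  assumes "M \<in> carrier_mat p (n * t)" and "k < n" and "r < p" and "c < t"
  shows "(M * unit_block n t k) $$ (r, c) = M $$ (r, k * t + c)"
proof -
  have "(M * unit_block n t k) $$ (r, c) =
      (\<Sum>j<n * t. M $$ (r, j) * (if j = k * t + c then 1 else 0))"
    using assms by (subst index_mult_mat_sum[of _ p "n * t" _ t]) (auto simp: index_unit_block)
  also have "\<dots> = M $$ (r, k * t + c)"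
    using block_index_less[OF assms(2,4)]
    by (simp add: if_distrib[of "\<lambda>x. _ * x"] cong: if_cong)
  finally show ?thesis .
qed

text \<open>Each column \<open>j\<close> sits in block column \<open>j div t\<close> at offset
  \<open>j mod t\<close>. Later identities between matrices with \<open>n\<close> block columns are
  reduced by this to products with block unit vectors, which need no inspection of entries.\<close>

lemma mat_eq_by_block_columns:
  fixes M N :: "'a :: semiring_1 mat"
  assumes M: "M \<in> carrier_mat p (n * t)" and N: "N \<in> carrier_mat p (n * t)"
    and eq: "\<And>k. k < n \<Longrightarrow> M * unit_block n t k = N * unit_block n t k"
  shows "M = N"
proof (rule eq_matI)
  fix r j assume "r < dim_row N" "j < dim_col N"
  then have r: "r < p" and j: "j < n * t" using N by auto
  note k = block_indices_less[OF j]
  have "M $$ (r, j div t * t + j mod t) = N $$ (r, j div t * t + j mod t)"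
    using eq[OF k(1)] index_mult_unit_block[OF M k(1) r k(2)] index_mult_unit_block[OF N k(1) r k(2)]
    by simp
  then show "M $$ (r, j) = N $$ (r, j)" by simp
qed (use M N in auto)

section \<open>Companion matrices as shifts of block unit vectors\<close>

lemma block_companion_carrier [simp, intro]: "block_companion n t P \<in> carrier_mat (n * t) (n * t)"
  by (simp add: block_companion_def mat_of_blocks_def)

text \<open>The product is block column \<open>k\<close>: a single identity block just below the
  diagonal, or \<open>P\<close> in the last column. For \<open>n = 1\<close> only the case of
  \<open>P\<close> occurs.\<close>

lemma block_companion_mult_unit_block:
  fixes P :: "'a :: semiring_1 mat"
  assumes P: "P \<in> carrier_mat (n * t) t" and k: "k < n"
  shows "block_companion n t P * unit_block n t k = (if k = n - 1 then P else unit_block n t (Suc k))"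
    (is "_ = ?R")
proof (rule eq_matI)
  fix r c assume "r < dim_row ?R" "c < dim_col ?R"
  then have r: "r < n * t" and c: "c < t" using P by (auto split: if_splits)
  note d = block_indices_less[OF r]
  have "(block_companion n t P * unit_block n t k) $$ (r, c) = block_companion n t P $$ (r, k * t + c)"
    using r c k by (intro index_mult_unit_block) auto
  also have "\<dots> = (if k = n - 1 then row_block t P (r div t)
            else if r div t = k + 1 then 1\<^sub>m t else 0\<^sub>m t t) $$ (r mod t, c)"
    using r c block_index_less[OF k c] by (simp add: block_companion_def mat_of_blocks_def)
  also have "\<dots> = ?R $$ (r, c)"
  proof (cases "k = n - 1")
    case True
    then show ?thesis using P d c by (simp add: row_block_def)
  next
    case False
    then have k': "Suc k < n" using k by simp
    have "r = Suc k * t + c \<longleftrightarrow> r div t = k + 1 \<and> r mod t = c"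
      using eq_block_index_iff[OF c, of r "Suc k"] by simp
    then show ?thesis using False d c index_unit_block[OF r c k'] by auto
  qed
  finally show "(block_companion n t P * unit_block n t k) $$ (r, c) = ?R $$ (r, c)" .
qed (use P in \<open>auto simp: block_companion_def mat_of_blocks_def\<close>)

section \<open>Reachability matrices\<close>

lemma reachability_mat_carrier [simp, intro]:
  "B \<in> carrier_mat p m \<Longrightarrow> reachability_mat n A B \<in> carrier_mat p (n * m)"
  by (simp add: reachability_mat_def mat_of_blocks_def)

lemma index_reachability_mat:
  assumes "B \<in> carrier_mat p m" and "k < n" and "r < p" and "c < m"
  shows "reachability_mat n A B $$ (r, k * m + c) = (A ^\<^sub>m k * B) $$ (r, c)"
  using assms block_index_less[of k n c m] by (auto simp: reachability_mat_def mat_of_blocks_def)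

lemma reachability_mat_mult_unit_block:
  assumes A: "A \<in> carrier_mat p p" and B: "B \<in> carrier_mat p m" and k: "k < n"
  shows "reachability_mat n A B * unit_block n m k = A ^\<^sub>m k * B"
proof (rule eq_matI)
  fix r c assume "r < dim_row (A ^\<^sub>m k * B)" "c < dim_col (A ^\<^sub>m k * B)"
  then have "r < p" "c < m" using A B by auto
  then show "(reachability_mat n A B * unit_block n m k) $$ (r, c) = (A ^\<^sub>m k * B) $$ (r, c)"
    using A B k by (simp add: index_mult_unit_block[where p = p] index_reachability_mat)
qed (use A B in \<open>auto simp: reachability_mat_def mat_of_blocks_def\<close>)

text \<open>This is a block row times a block column: \<open>sum_blocks\<close> groups the inner
  index by blocks of length \<open>m\<close>, and each group is an ordinary matrix product.\<close>

lemma reachability_mat_mult: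
  fixes A :: "'a :: semiring_1 mat"
  assumes A: "A \<in> carrier_mat p p" and B: "B \<in> carrier_mat p m" and G: "G \<in> carrier_mat (n * m) q"
  shows "reachability_mat n A B * G = mat_sum p q (\<lambda>k. A ^\<^sub>m k * B * row_block m G k) {..<n}"
proof (rule eq_matI)
  fix r c assume "r < dim_row (mat_sum p q (\<lambda>k. A ^\<^sub>m k * B * row_block m G k) {..<n})"
    and "c < dim_col (mat_sum p q (\<lambda>k. A ^\<^sub>m k * B * row_block m G k) {..<n})"
  then have rc: "r < p" "c < q" by auto
  have "(reachability_mat n A B * G) $$ (r, c) =
      (\<Sum>j<n * m. reachability_mat n A B $$ (r, j) * G $$ (j, c))"
    using reachability_mat_carrier[OF B] G rc by (rule index_mult_mat_sum)
  also have "\<dots> = (\<Sum>k<n. \<Sum>j<m. (A ^\<^sub>m k * B) $$ (r, j) * G $$ (k * m + j, c))"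
    unfolding sum_blocks using B rc by (intro sum.cong refl) (simp add: index_reachability_mat)
  also have "\<dots> = (\<Sum>k<n. (A ^\<^sub>m k * B * row_block m G k) $$ (r, c))"
  proof (rule sum.cong[OF refl])
    fix k assume "k \<in> {..<n}"
    have "A ^\<^sub>m k * B \<in> carrier_mat p m" "row_block m G k \<in> carrier_mat m q"
      using A B G by auto
    then have "(A ^\<^sub>m k * B * row_block m G k) $$ (r, c) =
        (\<Sum>j<m. (A ^\<^sub>m k * B) $$ (r, j) * row_block m G k $$ (j, c))"
      using rc by (rule index_mult_mat_sum)
    then show "(\<Sum>j<m. (A ^\<^sub>m k * B) $$ (r, j) * G $$ (k * m + j, c)) =
        (A ^\<^sub>m k * B * row_block m G k) $$ (r, c)"
      using rc G by (simp add: row_block_def)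
  qed
  finally show "(reachability_mat n A B * G) $$ (r, c) =
      mat_sum p q (\<lambda>k. A ^\<^sub>m k * B * row_block m G k) {..<n} $$ (r, c)"
    using rc by simp
qed (use A B G in \<open>auto simp: reachability_mat_def mat_of_blocks_def\<close>)

text \<open>Comparing block columns turns (ii) into the shift property of the powers of
  \<open>A\<close>, the form in which it is used below.\<close>

lemma reachability_mat_eq_one_iff:
  fixes A :: "'a :: semiring_1 mat"
  assumes A: "A \<in> carrier_mat (n * t) (n * t)"
  shows "reachability_mat n A (unit_block n t 0) = 1\<^sub>m (n * t) \<longleftrightarrow>
    (\<forall>k<n. A ^\<^sub>m k * unit_block n t 0 = unit_block n t k)"
    (is "?R = _ \<longleftrightarrow> _")
proof -
  have "?R = 1\<^sub>m (n * t) \<longleftrightarrow>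
      (\<forall>k<n. ?R * unit_block n t k = 1\<^sub>m (n * t) * unit_block n t k)"
    using mat_eq_by_block_columns[OF reachability_mat_carrier[OF unit_block_carrier] one_carrier_mat]
    by metis
  then show ?thesis
    using reachability_mat_mult_unit_block[OF A unit_block_carrier] by simp
qed

section \<open>Powers of \<open>A\<close> and the equivalence of (i) and (ii)\<close>

lemma pow_mat_add:
  assumes "A \<in> carrier_mat p p"
  shows "A ^\<^sub>m (i + j) = A ^\<^sub>m i * A ^\<^sub>m j"
proof (induction j)
  case 0
  then show ?case using assms right_mult_one_mat[OF pow_carrier_mat[OF assms]] by simp
next
  case (Suc j)
  then show ?case
    using assoc_mult_mat[OF pow_carrier_mat[OF assms] pow_carrier_mat[OF assms] assms] by simp
qed

text \<open>The recursion for \<open>^\<^sub>m\<close> puts the new factor on the right; the shift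
  argument needs it on the left, acting on \<open>A ^\<^sub>m k * B\<close>.\<close>

lemma pow_mat_Suc_mult:
  assumes A: "A \<in> carrier_mat p p" and B: "B \<in> carrier_mat p m"
  shows "A ^\<^sub>m Suc k * B = A * (A ^\<^sub>m k * B)"
proof -
  have "A ^\<^sub>m Suc k = A * A ^\<^sub>m k"
    using pow_mat_add[OF A, of 1 k] A by simp
  then show ?thesis using assoc_mult_mat[OF A pow_carrier_mat[OF A] B] by simp
qed

lemma block_companion_iff_reachability_mat:
  fixes A :: "'a :: semiring_1 mat"
  assumes n: "n \<ge> 1" and A: "A \<in> carrier_mat (n * t) (n * t)"
  shows "(\<exists>P \<in> carrier_mat (n * t) t. A = block_companion n t P) \<longleftrightarrow>
    reachability_mat n A (unit_block n t 0) = 1\<^sub>m (n * t)"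
proof
  assume "\<exists>P \<in> carrier_mat (n * t) t. A = block_companion n t P"
  then obtain P where P: "P \<in> carrier_mat (n * t) t" and AP: "A = block_companion n t P" by blast
  \<comment> \<open>A companion matrix sends each block unit vector except the last to the next one,
    so induction works up to \<open>n - 1\<close>.\<close>
  have "A ^\<^sub>m k * unit_block n t 0 = unit_block n t k" if "k < n" for k
    using that
  proof (induction k)
    case 0
    then show ?case using A by simp
  next
    case (Suc k)
    then have "A ^\<^sub>m Suc k * unit_block n t 0 = A * unit_block n t k"
      unfolding pow_mat_Suc_mult[OF A unit_block_carrier] by simp
    also have "\<dots> = unit_block n t (Suc k)"
      using Suc.prems block_companion_mult_unit_block[OF P, of k] unfolding AP by auto
    finally show ?case .
  qed
  then show "reachability_mat n A (unit_block n t 0) = 1\<^sub>m (n * t)"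
    using reachability_mat_eq_one_iff[OF A] by blast
next
  assume "reachability_mat n A (unit_block n t 0) = 1\<^sub>m (n * t)"
  then have pow: "A ^\<^sub>m k * unit_block n t 0 = unit_block n t k" if "k < n" for k
    using reachability_mat_eq_one_iff[OF A] that by blast
  \<comment> \<open>(ii) does not constrain the last block column of \<open>A\<close>, so this
    column has to serve as \<open>P\<close>.\<close>
  define P where "P = A * unit_block n t (n - 1)"
  have P: "P \<in> carrier_mat (n * t) t" using A by (simp add: P_def mult_carrier_mat[of _ _ "n * t"])
  have "A = block_companion n t P"
  proof (rule mat_eq_by_block_columns[OF A block_companion_carrier])
    fix k assume k: "k < n"
    \<comment> \<open>Write block unit vector \<open>k\<close> as
      \<open>A ^\<^sub>m k * unit_block n t 0\<close>; one more factor \<open>A\<close> gives the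
      next one, since \<open>Suc k < n\<close>.\<close>
    have "A * unit_block n t k = unit_block n t (Suc k)" if "k \<noteq> n - 1"
      using pow_mat_Suc_mult[OF A unit_block_carrier, of k 0] pow[of k] pow[of "Suc k"] k that by simp
    then show "A * unit_block n t k = block_companion n t P * unit_block n t k"
      using block_companion_mult_unit_block[OF P k] by (auto simp: P_def)
  qed
  with P show "\<exists>P \<in> carrier_mat (n * t) t. A = block_companion n t P" by blast
qed

section \<open>Kronecker products and the block columns of \<open>block_eval\<close>\<close>

lemma kronecker_product_carrier [simp, intro]:
  "S \<in> carrier_mat p q \<Longrightarrow> T \<in> carrier_mat r s \<Longrightarrow> S \<otimes>\<^sub>K T \<in> carrier_mat (p * r) (q * s)"
  by (auto simp: kronecker_product_def mat_of_blocks_def)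

text \<open>Both sides have \<open>C\<close> in block row \<open>k\<close> and zeros elsewhere. It
  is an instance of the mixed product rule for Kronecker products.\<close>

lemma one_kronecker_mult_unit_block:
  fixes C :: "'a :: semiring_1 mat"
  assumes C: "C \<in> carrier_mat t m" and k: "k < n"
  shows "(1\<^sub>m n \<otimes>\<^sub>K C) * unit_block n m k = unit_block n t k * C"
proof (rule eq_matI)
  fix r c assume "r < dim_row (unit_block n t k * C)" "c < dim_col (unit_block n t k * C)"
  then have r: "r < n * t" and c: "c < m" using C by auto
  note d = block_indices_less[OF r]
  have "((1\<^sub>m n \<otimes>\<^sub>K C) * unit_block n m k) $$ (r, c) = (1\<^sub>m n \<otimes>\<^sub>K C) $$ (r, k * m + c)"
    using C k r c by (intro index_mult_unit_block) auto
  also have "\<dots> = (if r div t = k then C $$ (r mod t, c) else 0)"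
    using C k c d r block_index_less[OF k c] by (simp add: kronecker_product_def mat_of_blocks_def)
  \<comment> \<open>The entry is spread over a sum with at most one nonzero term, to meet the sum
    that expands the product with \<open>C\<close>.\<close>
  also have "\<dots> = (\<Sum>j<t. if j = r mod t then if r div t = k then C $$ (j, c) else 0 else 0)"
    using d by simp
  also have "\<dots> = (\<Sum>j<t. unit_block n t k $$ (r, j) * C $$ (j, c))"
    using r k by (intro sum.cong) (auto simp: index_unit_block eq_block_index_iff)
  also have "\<dots> = (unit_block n t k * C) $$ (r, c)"
    using unit_block_carrier C r c by (rule index_mult_mat_sum[symmetric])
  finally show "((1\<^sub>m n \<otimes>\<^sub>K C) * unit_block n m k) $$ (r, c) = (unit_block n t k * C) $$ (r, c)" .
qed (use C in \<open>auto simp: kronecker_product_def mat_of_blocks_def\<close>)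

lemma block_eval_eq_mat_sum:
  assumes "B \<in> carrier_mat (n * t) m"
  shows "block_eval n t A B =
    mat_sum (n * t) (n * m) (\<lambda>i. A ^\<^sub>m i * (1\<^sub>m n \<otimes>\<^sub>K row_block t B i)) {..<n}"
  using assms by (auto simp: block_eval_def mat_sum_def)

text \<open>The block unit vector passes through the sum and through \<open>A ^\<^sub>m i\<close> to
  the block diagonal factor, where the previous exchange rule applies.\<close>

lemma block_eval_mult_unit_block:
  fixes A :: "'a :: semiring_1 mat"
  assumes A: "A \<in> carrier_mat (n * t) (n * t)" and B: "B \<in> carrier_mat (n * t) m" and k: "k < n"
  shows "block_eval n t A B * unit_block n m k =
    mat_sum (n * t) m (\<lambda>i. A ^\<^sub>m i * (unit_block n t k * row_block t B i)) {..<n}"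
proof -
  have K: "1\<^sub>m n \<otimes>\<^sub>K row_block t B i \<in> carrier_mat (n * t) (n * m)" for i
    by (rule kronecker_product_carrier[OF one_carrier_mat row_block_carrier[OF B]])
  have "A ^\<^sub>m i * (1\<^sub>m n \<otimes>\<^sub>K row_block t B i) * unit_block n m k =
      A ^\<^sub>m i * (unit_block n t k * row_block t B i)" for i
    using assoc_mult_mat[OF pow_carrier_mat[OF A] K unit_block_carrier]
      one_kronecker_mult_unit_block[OF row_block_carrier[OF B] k] by simp
  moreover have "block_eval n t A B * unit_block n m k =
      mat_sum (n * t) m (\<lambda>i. A ^\<^sub>m i * (1\<^sub>m n \<otimes>\<^sub>K row_block t B i) * unit_block n m k) {..<n}"
    unfolding block_eval_eq_mat_sum[OF B]
    using K A by (intro mat_sum_mult unit_block_carrier mult_carrier_mat[OF pow_carrier_mat])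
  ultimately show ?thesis by simp
qed

section \<open>Statements (iii) and (iv) in terms of (ii)\<close>

lemma reachability_mat_mult_unit_block_0:
  fixes A :: "'a :: semiring_1 mat"
  assumes n: "n \<ge> 1" and A: "A \<in> carrier_mat (n * t) (n * t)" and B: "B \<in> carrier_mat (n * t) t"
  shows "reachability_mat n A B * unit_block n t 0 = B"
  using reachability_mat_mult_unit_block[OF A B, of 0 n] n A B by simp

text \<open>Multiplying the identity \<open>R(A, E\<^sub>0) = I\<close> by \<open>G\<close> expands \<open>G\<close> in the powers of \<open>A\<close>.\<close>

lemma power_expansion:
  fixes A :: "'a :: semiring_1 mat"
  assumes A: "A \<in> carrier_mat (n * t) (n * t)" and G: "G \<in> carrier_mat (n * t) m"
    and R: "reachability_mat n A (unit_block n t 0) = 1\<^sub>m (n * t)"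
  shows "G = mat_sum (n * t) m (\<lambda>i. A ^\<^sub>m i * unit_block n t 0 * row_block t G i) {..<n}"
  using reachability_mat_mult[OF A unit_block_carrier G, of 0] unfolding R left_mult_one_mat[OF G] .

lemma reachability_mat_eq_block_eval:
  fixes A :: "'a :: semiring_1 mat"
  assumes A: "A \<in> carrier_mat (n * t) (n * t)" and G: "G \<in> carrier_mat (n * t) m"
    and R: "reachability_mat n A (unit_block n t 0) = 1\<^sub>m (n * t)"
  shows "reachability_mat n A G = block_eval n t A G"
proof (rule mat_eq_by_block_columns[OF reachability_mat_carrier[OF G]])
  show "block_eval n t A G \<in> carrier_mat (n * t) (n * m)"
    using G by (simp add: block_eval_eq_mat_sum)
  fix k assume k: "k < n"
  let ?E = "unit_block n t 0 :: 'a mat"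
  have Ai: "A ^\<^sub>m i \<in> carrier_mat (n * t) (n * t)" for i using A by simp
  have E: "?E \<in> carrier_mat (n * t) t" by simp
  have Gi: "row_block t G i \<in> carrier_mat t m" for i using G by blast
  have EG: "?E * row_block t G i \<in> carrier_mat (n * t) m" for i using E Gi by (rule mult_carrier_mat)
  \<comment> \<open>Powers of \<open>A\<close> commute, so \<open>A ^\<^sub>m k\<close> can be moved
    next to \<open>?E\<close>, where (ii) turns the product into block unit vector
    \<open>k\<close>.\<close>
  have swap: "A ^\<^sub>m k * (A ^\<^sub>m i * ?E * row_block t G i) = A ^\<^sub>m i * (unit_block n t k * row_block t G i)"
    for i
  proof -
    have "A ^\<^sub>m k * (A ^\<^sub>m i * ?E * row_block t G i) = A ^\<^sub>m k * A ^\<^sub>m i * (?E * row_block t G i)"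
      using assoc_mult_mat[OF Ai E Gi] assoc_mult_mat[OF Ai Ai EG] by simp
    also have "A ^\<^sub>m k * A ^\<^sub>m i = A ^\<^sub>m i * A ^\<^sub>m k"
      by (simp add: add.commute flip: pow_mat_add[OF A])
    also have "\<dots> * (?E * row_block t G i) = A ^\<^sub>m i * (A ^\<^sub>m k * ?E * row_block t G i)"
      using assoc_mult_mat[OF Ai E Gi] assoc_mult_mat[OF Ai Ai EG] by simp
    also have "A ^\<^sub>m k * ?E = unit_block n t k"
      using R k reachability_mat_eq_one_iff[OF A] by blast
    finally show ?thesis .
  qed
  have "reachability_mat n A G * unit_block n m k = A ^\<^sub>m k * G"
    by (rule reachability_mat_mult_unit_block[OF A G k])
  \<comment> \<open>\<open>G\<close> occurs on both sides of its expansion, which is therefore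
    inserted exactly once.\<close>
  also have "\<dots> = A ^\<^sub>m k * mat_sum (n * t) m (\<lambda>i. A ^\<^sub>m i * ?E * row_block t G i) {..<n}"
    by (rule arg_cong[OF power_expansion[OF A G R]])
  also have "\<dots> = mat_sum (n * t) m (\<lambda>i. A ^\<^sub>m k * (A ^\<^sub>m i * ?E * row_block t G i)) {..<n}"
    by (intro mult_mat_sum[OF Ai] mult_carrier_mat[OF mult_carrier_mat[OF Ai E] Gi])
  also have "\<dots> = block_eval n t A G * unit_block n m k"
    unfolding swap block_eval_mult_unit_block[OF A G k] ..
  finally show "reachability_mat n A G * unit_block n m k = block_eval n t A G * unit_block n m k" .
qed

text \<open>Among the row blocks of \<open>unit_block n t 0\<close> only block 0 is nonzero, and it
  is the identity; so only the term with \<open>A ^\<^sub>m 0\<close> survives.\<close>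

lemma block_eval_unit_block:
  fixes A :: "'a :: semiring_1 mat"
  assumes n: "n \<ge> 1" and A: "A \<in> carrier_mat (n * t) (n * t)"
  shows "block_eval n t A (unit_block n t 0) = 1\<^sub>m (n * t)"
proof (rule mat_eq_by_block_columns[OF _ one_carrier_mat])
  show "block_eval n t A (unit_block n t 0) \<in> carrier_mat (n * t) (n * t)"
    by (simp add: block_eval_eq_mat_sum[OF unit_block_carrier])
  fix k assume k: "k < n"
  let ?X = "\<lambda>i. A ^\<^sub>m i * (unit_block n t k * row_block t (unit_block n t 0) i)"
  have X: "?X i = (if i = 0 then unit_block n t k else 0\<^sub>m (n * t) t)" if "i < n" for i
    using that n A right_mult_one_mat[OF unit_block_carrier, of n t k]
      right_mult_zero_mat[OF pow_carrier_mat[OF A]] right_mult_zero_mat[OF unit_block_carrier]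
    by (simp add: row_block_unit_block)
  have "mat_sum (n * t) t ?X {..<n} =
      mat_sum (n * t) t (\<lambda>i. if i = 0 then unit_block n t k else 0\<^sub>m (n * t) t) {..<n}"
    using X by (intro mat_sum_cong) simp
  also have "\<dots> = unit_block n t k"
    using n by (intro eq_matI) (auto simp: if_distrib[of "\<lambda>M. M $$ _"] cong: if_cong)
  finally show "block_eval n t A (unit_block n t 0) * unit_block n t k = 1\<^sub>m (n * t) * unit_block n t k"
    by (simp add: block_eval_mult_unit_block[OF A unit_block_carrier k])
qed

lemma reachability_mat_mult_commute:
  fixes A :: "'a :: semiring_1 mat"
  assumes A: "A \<in> carrier_mat (n * t) (n * t)"
    and B: "B \<in> carrier_mat (n * t) t" and G: "G \<in> carrier_mat (n * t) t"
    and R: "reachability_mat n A (unit_block n t 0) = 1\<^sub>m (n * t)"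
    and comm: "blockwise_commuting n t B G"
  shows "reachability_mat n A B * G = reachability_mat n A G * B"
proof -
  let ?E = "unit_block n t 0 :: 'a mat"
  have Ai: "A ^\<^sub>m i \<in> carrier_mat (n * t) (n * t)" for i using A by simp
  have E: "?E \<in> carrier_mat (n * t) t" by simp
  \<comment> \<open>In this form the power of \<open>A\<close> depends only on \<open>k + i\<close>;
    the roles of \<open>X\<close> and \<open>Y\<close> differ only in the product of their
    blocks.\<close>
  have double_sum: "reachability_mat n A X * Y =
      mat_sum (n * t) t (\<lambda>k. mat_sum (n * t) t
        (\<lambda>i. A ^\<^sub>m (k + i) * ?E * (row_block t X i * row_block t Y k)) {..<n}) {..<n}"
    if X: "X \<in> carrier_mat (n * t) t" and Y: "Y \<in> carrier_mat (n * t) t" for X Y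
  proof -
    have Xi: "row_block t X i \<in> carrier_mat t t" and Yi: "row_block t Y i \<in> carrier_mat t t" for i
      using X Y by blast+
    have AE: "A ^\<^sub>m i * ?E \<in> carrier_mat (n * t) t" for i
      using Ai E by (rule mult_carrier_mat)
    have AEX: "A ^\<^sub>m i * ?E * row_block t X j \<in> carrier_mat (n * t) t" for i j
      using AE Xi by (rule mult_carrier_mat)
    have expand: "A ^\<^sub>m k * (A ^\<^sub>m i * ?E * row_block t X i) * row_block t Y k =
        A ^\<^sub>m (k + i) * ?E * (row_block t X i * row_block t Y k)" for i k
      unfolding pow_mat_add[OF A] assoc_mult_mat[OF Ai Ai E]
        assoc_mult_mat[OF Ai AE Xi, symmetric]
      by (rule assoc_mult_mat[OF mult_carrier_mat[OF Ai AE] Xi Yi])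
    have AkX: "A ^\<^sub>m k * X =
        mat_sum (n * t) t (\<lambda>i. A ^\<^sub>m k * (A ^\<^sub>m i * ?E * row_block t X i)) {..<n}" for k
      using arg_cong[OF power_expansion[OF A X R], of "(*) (A ^\<^sub>m k)"]
      unfolding mult_mat_sum[OF Ai AEX] .
    have "A ^\<^sub>m k * X * row_block t Y k = mat_sum (n * t) t
        (\<lambda>i. A ^\<^sub>m k * (A ^\<^sub>m i * ?E * row_block t X i) * row_block t Y k) {..<n}" for k
      unfolding AkX by (intro mat_sum_mult[OF Yi] mult_carrier_mat[OF Ai AEX])
    then show ?thesis unfolding reachability_mat_mult[OF A X Y] expand by simp
  qed
  \<comment> \<open>Commuting the blocks yields the double sum for
    \<open>reachability_mat n A G * B\<close> with the two summations interchanged.\<close>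
  have "reachability_mat n A B * G =
      mat_sum (n * t) t (\<lambda>k. mat_sum (n * t) t
        (\<lambda>i. A ^\<^sub>m (i + k) * ?E * (row_block t G k * row_block t B i)) {..<n}) {..<n}"
    unfolding double_sum[OF B G] using comm
    by (intro mat_sum_cong) (simp add: blockwise_commuting_def add.commute)
  also have "\<dots> = reachability_mat n A G * B"
    unfolding double_sum[OF G B] by (rule mat_sum_swap)
  finally show ?thesis .
qed

text \<open>The blocks of a block unit vector are zero and identity matrices, which commute with
  every square block. This makes block unit vectors admissible in (iv).\<close>

lemma blockwise_commuting_unit_block:
  fixes G :: "'a :: semiring_1 mat"
  assumes G: "G \<in> carrier_mat (n * t) t" and k: "k < n"
  shows "blockwise_commuting n t (unit_block n t k) G"
  by (simp add: blockwise_commuting_def row_block_unit_block k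
      left_mult_one_mat[OF row_block_carrier[OF G]] right_mult_one_mat[OF row_block_carrier[OF G]]
      left_mult_zero_mat[OF row_block_carrier[OF G]] right_mult_zero_mat[OF row_block_carrier[OF G]])

theorem theorem3p1:
  fixes A :: "'a :: field mat" and n t :: nat
  assumes "n \<ge> 1" and "t \<ge> 1" and "A \<in> carrier_mat (n * t) (n * t)"
  shows "((\<exists>P \<in> carrier_mat (n * t) t. A = block_companion n t P)
            \<longleftrightarrow> reachability_mat n A (unit_block n t 0) = 1\<^sub>m (n * t))
       \<and> (reachability_mat n A (unit_block n t 0) = 1\<^sub>m (n * t)
            \<longleftrightarrow> (\<forall>m \<ge> 1. \<forall>G \<in> carrier_mat (n * t) m. reachability_mat n A G = block_eval n t A G))
       \<and> ((\<forall>m \<ge> 1. \<forall>G \<in> carrier_mat (n * t) m. reachability_mat n A G = block_eval n t A G)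
            \<longleftrightarrow> (\<forall>B \<in> carrier_mat (n * t) t. \<forall>G \<in> carrier_mat (n * t) t.
                  blockwise_commuting n t B G \<longrightarrow>
                  reachability_mat n A B * G = reachability_mat n A G * B))"
    (is "(?i \<longleftrightarrow> ?ii) \<and> (_ \<longleftrightarrow> ?iii) \<and> (_ \<longleftrightarrow> ?iv)")
proof -
  note n = assms(1) and A = assms(3)
  have "?i \<longleftrightarrow> ?ii" by (rule block_companion_iff_reachability_mat[OF n A])
  moreover have "?iii" if ?ii
    using reachability_mat_eq_block_eval[OF A _ that] by blast
  \<comment> \<open>(iii) is taken at \<open>m = t\<close>, which is admissible as
    \<open>t \<ge> 1\<close>.\<close>
  moreover have "?ii" if ?iii
    using that assms(2) block_eval_unit_block[OF n A] unit_block_carrier by metis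
  moreover have "?iv" if ?ii
    using reachability_mat_mult_commute[OF A _ _ that] by blast
  \<comment> \<open>Each choice of \<open>k\<close> in (iv) determines one block column of the
    reachability matrix of \<open>unit_block n t 0\<close>; together they determine all of
    it.\<close>
  moreover have "?ii" if iv: ?iv
  proof (rule mat_eq_by_block_columns[OF reachability_mat_carrier[OF unit_block_carrier] one_carrier_mat])
    fix k assume "k < n"
    have "reachability_mat n A (unit_block n t 0) * unit_block n t k =
        reachability_mat n A (unit_block n t k) * unit_block n t 0"
      using n by (intro iv[rule_format] unit_block_carrier blockwise_commuting_unit_block) simp
    also have "\<dots> = unit_block n t k"
      by (rule reachability_mat_mult_unit_block_0[OF n A unit_block_carrier])
    finally show "reachability_mat n A (unit_block n t 0) * unit_block n t k =
        1\<^sub>m (n * t) * unit_block n t k" by simp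
  qed
  ultimately show ?thesis by blast
qed

end
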